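(* Let $N\ge2$ and let $\Omega_\varepsilon=\{x\in\mathbb{R}^N:\varepsilon<|x|<1\}$. Let $u_\varepsilon=u_\varepsilon(r)$, $r=|x|$, be a radial solution of $-\Delta u=f(u)$, $u>0$ in $\Omega_\varepsilon$, $u=0$ on $\partial\Omega_\varepsilon$, with $|u_\varepsilon|\le C$ in $\Omega_\varepsilon$, $C$ independent of $\varepsilon$, and let $u_0$ be its weak limit. Assume that $f(s)>0$ for $s>0$. Then for $\varepsilon>0$ small enough $u_\varepsilon(r)$ has a unique critical point $r=r_\varepsilon$, and as $\varepsilon\to0$ $$r_\varepsilon=\begin{cases}\left[\left(\dfrac{N(N-2)u_0(0)}{f(u_0(0))}\right)^{\frac1N}+o(1)\right]\varepsilon^{\frac{N-2}{N}} & \text{if } N\ge3,\\[3mm] \left(\sqrt{\dfrac{2u_0(0)}{f(u_0(0))}}+o(1)\right)\dfrac{1}{\sqrt{|\log\varepsilon|}} & \text{if } N=2.\end{cases}$$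
   Context: Here $f:\mathbb{R}\to\mathbb{R}$ is smooth. A sequence $\varepsilon_n\to0^+$ is fixed; we write $\varepsilon$ for $\varepsilon_n$, and "$\varepsilon\to0$", "$o(1)$", "$\varepsilon$ small enough" refer to $n\to\infty$. With $D=\{|x|<1\}$, the weak limit $u_0$ is as follows: extending $u_\varepsilon$ by $0$ to $\{|x|\le\varepsilon\}$, $u_\varepsilon\rightharpoonup u_0$ weakly in $H^1_0(D)$, $u_\varepsilon\to u_0$ in $C^2(K)$ for every compact $K\subset D\setminus\{0\}$, and $u_0$ is a $C^2$ solution of $-\Delta u_0=f(u_0)$ in $D$, $u_0>0$ in $D$, $u_0=0$ on $\partial D$. $u_0(0)$ is the value of $u_0$ at the origin. *)

theory Defs
  imports "HOL-Analysis.Analysis"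
begin

section \<open>Functions of class \<open>C\<^sup>k\<close> and classical solutions\<close>

definition pd :: "'a::euclidean_space \<Rightarrow> ('a \<Rightarrow> real) \<Rightarrow> 'a \<Rightarrow> real" where
  "pd b g x = frechet_derivative g (at x) b"

text \<open>
  Meaningful for open \<open>S\<close>, where \<open>differentiable_on\<close> is differentiability at every point.
  The type \<open>real\<close> is itself a Euclidean space with \<open>Basis = {1}\<close>, so that this also
  covers functions of one real variable.
\<close>
fun Ck_on :: "nat \<Rightarrow> 'a::euclidean_space set \<Rightarrow> ('a \<Rightarrow> real) \<Rightarrow> bool" where
  "Ck_on 0 S g \<longleftrightarrow> continuous_on S g"
| "Ck_on (Suc k) S g \<longleftrightarrow> g differentiable_on S \<and> (\<forall>b\<in>Basis. Ck_on k S (pd b g))"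

definition smooth :: "('a::euclidean_space \<Rightarrow> real) \<Rightarrow> bool" where
  "smooth g \<longleftrightarrow> (\<forall>k. Ck_on k UNIV g)"

definition laplacian :: "('a::euclidean_space \<Rightarrow> real) \<Rightarrow> 'a \<Rightarrow> real" where
  "laplacian g x = (\<Sum>b\<in>Basis. pd b (pd b g) x)"

text \<open>
  \<open>-\<Delta>u = f(u)\<close> and \<open>u > 0\<close> in \<open>S\<close>, \<open>u = 0\<close> on the boundary, with
  \<open>u\<close> of class \<open>C\<^sup>2\<close> in \<open>S\<close> and continuous up to the boundary.
\<close>
definition positive_solution ::
    "(real \<Rightarrow> real) \<Rightarrow> 'a::euclidean_space set \<Rightarrow> ('a \<Rightarrow> real) \<Rightarrow> bool" where
  "positive_solution f S u \<longleftrightarrow>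
     Ck_on 2 S u \<and> continuous_on (closure S) u \<and>
     (\<forall>x\<in>S. - laplacian u x = f (u x)) \<and>
     (\<forall>x\<in>S. u x > 0) \<and>
     (\<forall>x\<in>frontier S. u x = 0)"

definition annulus :: "real \<Rightarrow> 'a::euclidean_space set" where
  "annulus e = {x. e < norm x \<and> norm x < 1}"

definition zero_ext :: "real \<Rightarrow> ('a::euclidean_space \<Rightarrow> real) \<Rightarrow> 'a \<Rightarrow> real" where
  "zero_ext e u x = (if norm x \<le> e then 0 else u x)"

definition C2_converges_on ::
    "'a::euclidean_space set \<Rightarrow> (nat \<Rightarrow> 'a \<Rightarrow> real) \<Rightarrow> ('a \<Rightarrow> real) \<Rightarrow> bool" where
  "C2_converges_on K g h \<longleftrightarrow>
     uniform_limit K g h sequentially \<and>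
     (\<forall>b\<in>Basis. uniform_limit K (\<lambda>n. pd b (g n)) (pd b h) sequentially) \<and>
     (\<forall>b\<in>Basis. \<forall>c\<in>Basis.
        uniform_limit K (\<lambda>n. pd c (pd b (g n))) (pd c (pd b h)) sequentially)"


section \<open>The Sobolev space \<open>H\<^sup>1\<^sub>0\<close> and weak convergence in it\<close>

definition test_function :: "'a::euclidean_space set \<Rightarrow> ('a \<Rightarrow> real) \<Rightarrow> bool" where
  "test_function S \<phi> \<longleftrightarrow>
     smooth \<phi> \<and> compact (closure {x. \<phi> x \<noteq> 0}) \<and> closure {x. \<phi> x \<noteq> 0} \<subseteq> S"

definition L2_on ::
    "'a::euclidean_space set \<Rightarrow> ('a \<Rightarrow> 'b::euclidean_space) \<Rightarrow> bool" where
  "L2_on S v \<longleftrightarrow>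
     v \<in> borel_measurable (lebesgue_on S) \<and> integrable (lebesgue_on S) (\<lambda>x. (norm (v x))\<^sup>2)"

definition is_weak_grad ::
    "'a::euclidean_space set \<Rightarrow> ('a \<Rightarrow> real) \<Rightarrow> ('a \<Rightarrow> 'a) \<Rightarrow> bool" where
  "is_weak_grad S v G \<longleftrightarrow>
     L2_on S G \<and>
     (\<forall>\<phi>. test_function S \<phi> \<longrightarrow> (\<forall>b\<in>Basis.
        integral\<^sup>L (lebesgue_on S) (\<lambda>x. v x * pd b \<phi> x) =
        - integral\<^sup>L (lebesgue_on S) (\<lambda>x. (G x \<bullet> b) * \<phi> x)))"

definition H1 :: "'a::euclidean_space set \<Rightarrow> ('a \<Rightarrow> real) set" where
  "H1 S = {v. L2_on S v \<and> (\<exists>G. is_weak_grad S v G)}"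

text \<open>The choice is immaterial: weak gradients are unique almost everywhere.\<close>
definition weak_grad :: "'a::euclidean_space set \<Rightarrow> ('a \<Rightarrow> real) \<Rightarrow> 'a \<Rightarrow> 'a" where
  "weak_grad S v = (SOME G. is_weak_grad S v G)"

definition H1_norm :: "'a::euclidean_space set \<Rightarrow> ('a \<Rightarrow> real) \<Rightarrow> real" where
  "H1_norm S v =
     sqrt (integral\<^sup>L (lebesgue_on S) (\<lambda>x. (v x)\<^sup>2) +
           integral\<^sup>L (lebesgue_on S) (\<lambda>x. (norm (weak_grad S v x))\<^sup>2))"

text \<open>The closure of the test functions in \<open>H\<^sup>1\<close>.\<close>
definition H10 :: "'a::euclidean_space set \<Rightarrow> ('a \<Rightarrow> real) set" where
  "H10 S = {v \<in> H1 S. \<exists>\<phi>. (\<forall>k. test_function S (\<phi> k)) \<and>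
                          (\<lambda>k. H1_norm S (\<lambda>x. \<phi> k x - v x)) \<longlonglongrightarrow> 0}"

text \<open>
  Elements of \<open>H10 S\<close> are functions rather than classes modulo null sets; boundedness
  makes a functional invariant under changes on null sets.
\<close>
definition H10_functional ::
    "'a::euclidean_space set \<Rightarrow> (('a \<Rightarrow> real) \<Rightarrow> real) \<Rightarrow> bool" where
  "H10_functional S L \<longleftrightarrow>
     (\<forall>v\<in>H10 S. \<forall>w\<in>H10 S. \<forall>a b. L (\<lambda>x. a * v x + b * w x) = a * L v + b * L w) \<and>
     (\<exists>M. \<forall>v\<in>H10 S. \<bar>L v\<bar> \<le> M * H1_norm S v)"

definition weakly_converges_H10 ::
    "'a::euclidean_space set \<Rightarrow> (nat \<Rightarrow> 'a \<Rightarrow> real) \<Rightarrow> ('a \<Rightarrow> real) \<Rightarrow> bool" where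
  "weakly_converges_H10 S v w \<longleftrightarrow>
     (\<forall>n. v n \<in> H10 S) \<and> w \<in> H10 S \<and>
     (\<forall>L. H10_functional S L \<longrightarrow> (\<lambda>n. L (v n)) \<longlonglongrightarrow> L w)"

end

theory Submission
  imports Defs
begin

text \<open>
  In polar form the flux \<open>W = r\<^bsup>N-1\<^esup> u'\<close> satisfies \<open>W' = - r\<^bsup>N-1\<^esup> f(u) < 0\<close>, hence has exactly one zero
  \<open>r\<^sub>\<epsilon>\<close>, the maximum point. If \<open>r\<^sub>\<epsilon>\<close> stayed away from \<open>0\<close>, the flux would be bounded below
  near the inner boundary and \<open>u\<close> would grow like the fundamental solution \<open>G\<close>, contradicting
  the uniform bound; so \<open>r\<^sub>\<epsilon> \<rightarrow> 0\<close>, and since \<open>u' \<ge> - M r\<close> beyond \<open>r\<^sub>\<epsilon>\<close>, \<open>u(r\<^sub>\<epsilon>) \<rightarrow> u\<^sub>0(0) =: a\<close>.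
  On \<open>[\<eta> r\<^sub>\<epsilon>, r\<^sub>\<epsilon>]\<close> the solution is uniformly close to \<open>a\<close>, so at small radii the flux is
  \<open>(f(a) + o(1)) r\<^sub>\<epsilon>\<^bsup>N\<^esup> / N\<close>. Integrating \<open>u' = W r\<^bsup>1-N\<^esup>\<close> from \<open>\<epsilon>\<close> to \<open>r\<^sub>\<epsilon>\<close> gives
  \<open>a = (f(a) + o(1)) r\<^sub>\<epsilon>\<^bsup>N\<^esup> |G(\<epsilon>)| / N\<close>, which is the asserted asymptotics.
\<close>

section \<open>Radial functions and the polar form of the Laplacian\<close>

lemma has_real_derivative_along_line:
  fixes F :: "'a::euclidean_space \<Rightarrow> real"
  assumes "F differentiable at (y + t0 *\<^sub>R b)"
  shows "((\<lambda>t. F (y + t *\<^sub>R b)) has_real_derivative pd b F (y + t0 *\<^sub>R b)) (at t0)"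
proof -
  let ?F' = "frechet_derivative F (at (y + t0 *\<^sub>R b))"
  have F: "(F has_derivative ?F') (at (y + t0 *\<^sub>R b))"
    using assms frechet_derivative_works by blast
  have "((\<lambda>t. y + t *\<^sub>R b) has_derivative (\<lambda>h. h *\<^sub>R b)) (at t0)"
    by (auto intro!: derivative_eq_intros)
  from has_derivative_compose[OF this F]
  have "((\<lambda>t. F (y + t *\<^sub>R b)) has_derivative (\<lambda>h. ?F' (h *\<^sub>R b))) (at t0)" .
  moreover have "?F' (h *\<^sub>R b) = pd b F (y + t0 *\<^sub>R b) * h" for h
    using linear_scale[OF has_derivative_linear[OF F]] by (simp add: pd_def mult.commute)
  ultimately show ?thesis
    by (simp add: has_field_derivative_def)
qed

lemma open_annulus: "open (annulus e :: 'a::euclidean_space set)"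
proof -
  have "annulus e = norm -` {e<..<1::real} \<inter> (UNIV :: 'a set)"
    by (auto simp: annulus_def)
  then show ?thesis
    by (metis Int_UNIV_right continuous_on_norm_id open_greaterThanLessThan open_vimage)
qed

lemma radial_pd:
  fixes U :: "real \<Rightarrow> real"
  assumes "(U has_real_derivative v) (at (norm x))" and "(x::'a::euclidean_space) \<noteq> 0"
  shows "pd b (\<lambda>x. U (norm x)) x = v * (x \<bullet> b) / norm x"
proof -
  have "((\<lambda>x. U (norm x)) has_derivative (\<lambda>h. v * (sgn x \<bullet> h))) (at x)"
    using has_derivative_compose[OF has_derivative_norm[OF assms(2)], of U "(*) v"] assms(1)
    by (simp add: has_field_derivative_def inner_commute)
  then have "frechet_derivative (\<lambda>x. U (norm x)) (at x) = (\<lambda>h. v * (sgn x \<bullet> h))"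
    using frechet_derivative_at by metis
  then show ?thesis
    by (simp add: pd_def sgn_div_norm field_simps)
qed

text \<open>At a point of a coordinate axis the second partial derivative along that axis is
  \<open>U''\<close>, and each of the remaining \<open>DIM('a) - 1\<close> ones is
  \<open>U' / r\<close>. Axis points suffice, because every radius is attained on an axis.
  \<open>V\<close> is read off from \<open>F\<close> along one fixed axis, so the regularity of
  \<open>U\<close> is inherited from that of \<open>F\<close>.\<close>

lemma radial_laplacian:
  fixes U :: "real \<Rightarrow> real" and e :: real
  defines "F \<equiv> \<lambda>x::'a::euclidean_space. U (norm x)"
  assumes C2: "Ck_on 2 (annulus e) F" and e: "0 < e"
  obtains V V2 :: "real \<Rightarrow> real" where
    "\<And>r. e < r \<Longrightarrow> r < 1 \<Longrightarrow> (U has_real_derivative V r) (at r)"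
    "\<And>r. e < r \<Longrightarrow> r < 1 \<Longrightarrow> (V has_real_derivative V2 r) (at r)"
    "\<And>r b. e < r \<Longrightarrow> r < 1 \<Longrightarrow> b \<in> Basis \<Longrightarrow>
       laplacian F (r *\<^sub>R b) = V2 r + (real DIM('a) - 1) * V r / r"
proof -
  obtain b0 :: 'a where b0: "b0 \<in> Basis"
    using nonempty_Basis by blast
  let ?S = "annulus e :: 'a set"
  have op: "open ?S"
    by (rule open_annulus)
  have F1: "F differentiable at x" if "x \<in> ?S" for x
    using C2 that op
    by (auto simp: numeral_2_eq_2 differentiable_on_eq_differentiable_at)
  have F2: "pd b F differentiable at x" if "x \<in> ?S" "b \<in> Basis" for x b
    using C2 that op
    by (auto simp: numeral_2_eq_2 differentiable_on_eq_differentiable_at)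
  have rb: "r *\<^sub>R b \<in> ?S" if "e < r" "r < 1" "b \<in> Basis" for r b
    using that e by (auto simp: annulus_def)
  define V where "V r = pd b0 F (r *\<^sub>R b0)" for r
  define V2 where "V2 r = pd b0 (pd b0 F) (r *\<^sub>R b0)" for r
  have V: "(U has_real_derivative V r) (at r)" if r: "e < r" "r < 1" for r
  proof (rule DERIV_cong_ev[THEN iffD1, OF refl _ refl])
    show "((\<lambda>t. F (0 + t *\<^sub>R b0)) has_real_derivative V r) (at r)"
      using has_real_derivative_along_line[of F 0 r b0] F1[OF rb[OF r b0]] by (simp add: V_def)
    \<comment> \<open>Along the axis the norm is the absolute value of \<open>t\<close>, so
      \<open>F\<close> and \<open>U\<close> agree only for positive \<open>t\<close>.\<close>
    have "\<forall>\<^sub>F t in nhds r. t \<in> {0<..}"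
      using r e by (intro eventually_nhds_in_open) auto
    then show "\<forall>\<^sub>F t in nhds r. F (0 + t *\<^sub>R b0) = U t"
      by eventually_elim (use b0 in \<open>auto simp: F_def\<close>)
  qed
  have V2: "(V has_real_derivative V2 r) (at r)" if r: "e < r" "r < 1" for r
    using has_real_derivative_along_line[of "pd b0 F" 0 r b0] F2[OF rb[OF r b0] b0]
    by (simp add: V_def[abs_def] V2_def)
  have pdF: "pd b F x = V (norm x) * (x \<bullet> b) / norm x" if "x \<in> ?S" for x b
  proof -
    have x: "e < norm x" "norm x < 1"
      using that by (auto simp: annulus_def)
    then have "x \<noteq> 0"
      using e by auto
    then show ?thesis
      using radial_pd[OF V[OF x]] by (simp add: F_def)
  qed
  have diag: "pd b (pd b F) (r *\<^sub>R b) = V2 r" if r: "e < r" "r < 1" and b: "b \<in> Basis" for r b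
  proof (rule DERIV_unique)
    show "((\<lambda>t. pd b F (0 + t *\<^sub>R b)) has_real_derivative pd b (pd b F) (r *\<^sub>R b)) (at r)"
      using has_real_derivative_along_line[of "pd b F" 0 r b] F2[OF rb[OF r b] b] by simp
    show "((\<lambda>t. pd b F (0 + t *\<^sub>R b)) has_real_derivative V2 r) (at r)"
    proof (rule DERIV_cong_ev[THEN iffD1, OF refl _ refl, OF _ V2[OF r]])
      have "\<forall>\<^sub>F t in nhds r. t \<in> {e<..<1}"
        using r e by (intro eventually_nhds_in_open) auto
      then show "\<forall>\<^sub>F t in nhds r. V t = pd b F (0 + t *\<^sub>R b)"
        by eventually_elim (use b e rb in \<open>auto simp: pdF\<close>)
    qed
  qed
  have offdiag: "pd b (pd b F) (r *\<^sub>R c) = V r / r"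
    if r: "e < r" "r < 1" and b: "b \<in> Basis" and c: "c \<in> Basis" and bc: "b \<noteq> c" for r b c
  proof (rule DERIV_unique)
    let ?y = "\<lambda>t. r *\<^sub>R c + t *\<^sub>R b"
    have y0: "norm (?y 0) = r"
      using r e c by simp
    have cont: "isCont (\<lambda>t. norm (?y t)) 0"
      by (intro continuous_intros)
    have ev: "\<forall>\<^sub>F t in nhds 0. ?y t \<in> ?S"
    proof (rule topological_tendstoD[OF _ op])
      show "(?y \<longlongrightarrow> r *\<^sub>R c + 0 *\<^sub>R b) (nhds 0)"
        by (intro tendsto_intros filterlim_ident)
    qed (use rb[OF r c] in simp)
    show "((\<lambda>t. pd b F (?y t)) has_real_derivative pd b (pd b F) (r *\<^sub>R c)) (at 0)"
      using has_real_derivative_along_line[of "pd b F" "r *\<^sub>R c" 0 b] F2[OF rb[OF r c] b] by simp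
    \<comment> \<open>On the line through \<open>r *\<^sub>R c\<close> in direction
      \<open>b\<close>, the inner product with \<open>b\<close> is \<open>t\<close>, so the partial
      derivative is \<open>t\<close> times a continuous factor. By Caratheodory's criterion its
      derivative at 0 is the value of that factor.\<close>
    have "isCont V (norm (?y 0))"
      unfolding y0 using V2[OF r] by (rule DERIV_isCont)
    then have "isCont (\<lambda>t. V (norm (?y t))) 0"
      using isCont_o2[OF cont] by blast
    then have "isCont (\<lambda>t. V (norm (?y t)) / norm (?y t)) 0"
      using y0 r e by (intro isCont_divide cont) simp_all
    then have "((\<lambda>t. V (norm (?y t)) / norm (?y t) * t) has_real_derivative V r / r) (at 0)"
      unfolding CARAT_DERIV
      by (intro exI[of _ "\<lambda>t. V (norm (?y t)) / norm (?y t)"]) (use y0 in auto)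
    then show "((\<lambda>t. pd b F (?y t)) has_real_derivative V r / r) (at 0)"
    proof (rule DERIV_cong_ev[THEN iffD1, OF refl _ refl, rotated])
      show "\<forall>\<^sub>F t in nhds 0. V (norm (?y t)) / norm (?y t) * t = pd b F (?y t)"
        using ev by eventually_elim (use b c bc in \<open>auto simp: pdF inner_add_left inner_Basis\<close>)
    qed
  qed
  have lap: "laplacian F (r *\<^sub>R b) = V2 r + (real DIM('a) - 1) * V r / r"
    if r: "e < r" "r < 1" and b: "b \<in> Basis" for r b
  proof -
    have "laplacian F (r *\<^sub>R b) = V2 r + (\<Sum>c\<in>Basis - {b}. pd c (pd c F) (r *\<^sub>R b))"
      unfolding laplacian_def using b diag[OF r b] by (simp add: sum.remove[of _ b])
    also have "(\<Sum>c\<in>Basis - {b}. pd c (pd c F) (r *\<^sub>R b)) = (\<Sum>c\<in>Basis - {b}. V r / r)"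
      using offdiag[OF r] b by (intro sum.cong) auto
    also have "\<dots> = (real DIM('a) - 1) * V r / r"
      using b by (simp add: of_nat_diff Suc_leI)
    finally show ?thesis .
  qed
  show thesis
    using that V V2 lap by blast
qed

text \<open>\<open>W\<close> stands for the flux \<open>r\<^bsup>d-1\<^esup> U'(r)\<close>.\<close>
locale radial_solution =
  fixes d :: nat and f :: "real \<Rightarrow> real" and C e :: real and U W :: "real \<Rightarrow> real"
  assumes d: "2 \<le> d"
    and f_pos: "\<And>s. s > 0 \<Longrightarrow> f s > 0"
    and e: "0 < e" "e < 1"
    and U_cont: "continuous_on {e..1} U"
    and U_bdry: "U e = 0" "U 1 = 0"
    and U_pos: "\<And>r. e < r \<Longrightarrow> r < 1 \<Longrightarrow> 0 < U r"
    and U_le: "\<And>r. e < r \<Longrightarrow> r < 1 \<Longrightarrow> U r \<le> C"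
    and U_deriv: "\<And>r. e < r \<Longrightarrow> r < 1 \<Longrightarrow> (U has_real_derivative W r / r ^ (d - 1)) (at r)"
    and W_deriv: "\<And>r. e < r \<Longrightarrow> r < 1 \<Longrightarrow>
                    (W has_real_derivative - (r ^ (d - 1) * f (U r))) (at r)"

text \<open>Restriction to the ray spanned by a basis vector turns the equation into an ordinary
  one; multiplying by the integrating factor \<open>r ^ (d - 1)\<close> puts it in divergence form,
  which defines the flux.\<close>

lemma positive_solution_radial:
  fixes U :: "real \<Rightarrow> real"
  assumes sol: "positive_solution f (annulus e) (\<lambda>x::'a::euclidean_space. U (norm x))"
    and d: "2 \<le> DIM('a)" and f_pos: "\<And>s. s > 0 \<Longrightarrow> f s > 0" and e: "0 < e" "e < 1"
    and bound: "\<forall>x::'a \<in> annulus e. \<bar>U (norm x)\<bar> \<le> C"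
  shows "\<exists>W. radial_solution DIM('a) f C e U W"
proof -
  let ?S = "annulus e :: 'a set"
  obtain b :: 'a where b: "b \<in> Basis"
    using nonempty_Basis by blast
  have rb: "r *\<^sub>R b \<in> ?S" if "e < r" "r < 1" for r
    using that e b by (auto simp: annulus_def)
  have nb: "norm (r *\<^sub>R b) = r" if "e \<le> r" for r
    using that e b by simp
  have C2: "Ck_on 2 ?S (\<lambda>x. U (norm x))"
    using sol by (simp add: positive_solution_def)
  obtain V V2 where V: "\<And>r. e < r \<Longrightarrow> r < 1 \<Longrightarrow> (U has_real_derivative V r) (at r)"
    and V2: "\<And>r. e < r \<Longrightarrow> r < 1 \<Longrightarrow> (V has_real_derivative V2 r) (at r)"
    and lap: "\<And>r b. e < r \<Longrightarrow> r < 1 \<Longrightarrow> b \<in> Basis \<Longrightarrow>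
       laplacian (\<lambda>x::'a. U (norm x)) (r *\<^sub>R b) = V2 r + (real DIM('a) - 1) * V r / r"
    using radial_laplacian[OF C2 e(1)] by metis
  \<comment> \<open>A continuous map sends closure into closure, so the end points of the segment
    land in the closure of the annulus; being outside the annulus, they lie on its frontier.\<close>
  have "(\<lambda>r. r *\<^sub>R b) ` closure {e<..<1} \<subseteq> closure ?S"
    by (intro image_closure_subset continuous_intros) (auto intro!: subsetD[OF closure_subset] rb)
  then have cl: "(\<lambda>r. r *\<^sub>R b) ` {e..1} \<subseteq> closure ?S"
    using e by simp
  have fr: "r *\<^sub>R b \<in> frontier ?S" if "r = e \<or> r = 1" for r
  proof -
    have "r *\<^sub>R b \<in> closure ?S"
      using that e by (intro subsetD[OF cl] imageI) auto
    moreover have "r *\<^sub>R b \<notin> ?S"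
      using that e b by (auto simp: annulus_def)
    ultimately show ?thesis
      by (simp add: frontier_def interior_open open_annulus)
  qed
  have "continuous_on ((\<lambda>r. r *\<^sub>R b) ` {e..1}) (\<lambda>x. U (norm x))"
    using sol cl by (auto simp: positive_solution_def intro: continuous_on_subset)
  then have "continuous_on {e..1} (\<lambda>r. U (norm (r *\<^sub>R b)))"
    by (rule continuous_on_compose2) (auto intro!: continuous_intros)
  then have cont: "continuous_on {e..1} U"
    using nb by (subst continuous_on_cong[OF refl, of _ U "\<lambda>r. U (norm (r *\<^sub>R b))"]) auto
  have ode: "V2 r + (real DIM('a) - 1) * V r / r = - f (U r)" if "e < r" "r < 1" for r
    using sol rb[OF that] lap[OF that b] nb[of r] that by (auto simp: positive_solution_def)
  have bdry: "U r = 0" if "r = e \<or> r = 1" for r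
    using sol fr[OF that] nb[of r] that e by (auto simp: positive_solution_def)
  have W: "((\<lambda>r. r ^ (DIM('a) - 1) * V r) has_real_derivative
             - (r ^ (DIM('a) - 1) * f (U r))) (at r)" if r: "e < r" "r < 1" for r
  proof -
    obtain k where k: "DIM('a) = Suc (Suc k)"
      using d by (metis Suc_le_D numeral_2_eq_2 Suc_le_mono)
    have "r > 0" using r e by linarith
    have "((\<lambda>r. r ^ Suc k * V r) has_real_derivative
            (1 + real k) * r ^ k * V r + V2 r * r ^ Suc k) (at r)"
      using DERIV_mult[OF DERIV_pow[of "Suc k"] V2[OF r]] by simp
    also have "(1 + real k) * r ^ k * V r + V2 r * r ^ Suc k
                 = r ^ Suc k * (V2 r + (real DIM('a) - 1) * V r / r)"
      using \<open>r > 0\<close> by (simp add: k field_simps)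
    finally show ?thesis
      unfolding ode[OF r] by (simp add: k)
  qed
  have "radial_solution DIM('a) f C e U (\<lambda>r. r ^ (DIM('a) - 1) * V r)"
  proof
    show "0 < U r" "U r \<le> C" if "e < r" "r < 1" for r
      using sol rb[OF that] nb[of r] that bound by (force simp: positive_solution_def)+
    show "(U has_real_derivative r ^ (DIM('a) - 1) * V r / r ^ (DIM('a) - 1)) (at r)"
      if "e < r" "r < 1" for r
      using V[OF that] that e by simp
  qed (use d f_pos e cont bdry W in auto)
  then show ?thesis by blast
qed

section \<open>The fundamental solution\<close>

text \<open>The radial fundamental solution of the Laplacian up to a positive factor, normalised to
  have flux 1. The additive constant makes it negative on the unit interval.\<close>

definition fundsol :: "nat \<Rightarrow> real \<Rightarrow> real" where
  "fundsol d r = (if d = 2 then ln r else - 1 / (real (d - 2) * r ^ (d - 2)))"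

lemma fundsol_deriv:
  assumes "2 \<le> d" "0 < r"
  shows "(fundsol d has_real_derivative 1 / r ^ (d - 1)) (at r)"
proof (cases "d = 2")
  case True
  then have "fundsol d = ln"
    by (auto simp: fundsol_def)
  then show ?thesis
    using assms True by (auto intro!: derivative_eq_intros simp: field_simps)
next
  case False
  then obtain k where k: "d = Suc (Suc (Suc k))"
    using assms(1) by (metis Suc_le_D numeral_2_eq_2 Suc_le_mono not0_implies_Suc)
  define m where "m = Suc k"
  have "fundsol d = (\<lambda>r. - (1 / real m) * inverse (r ^ m))"
    by (auto simp: fundsol_def fun_eq_iff k m_def field_simps)
  moreover have "((\<lambda>r. - (1 / real m) * inverse (r ^ m)) has_real_derivative
      - (1 / real m) * - (inverse (r ^ m) * (real m * r ^ (m - 1)) * inverse (r ^ m))) (at r)"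
    using DERIV_cmult[OF DERIV_inverse'[OF DERIV_pow[of m r UNIV]], of "- (1 / real m)"] assms
    by simp
  moreover have "- (1 / real m) * - (inverse (r ^ m) * (real m * r ^ (m - 1)) * inverse (r ^ m))
      = 1 / r ^ (d - 1)"
    using assms by (simp add: k m_def divide_simps)
  ultimately show ?thesis
    by metis
qed

lemma fundsol_cont: "2 \<le> d \<Longrightarrow> 0 < p \<Longrightarrow> continuous_on {p..q} (fundsol d)"
  by (rule DERIV_continuous_on, rule has_field_derivative_at_within, rule fundsol_deriv) auto

lemma fundsol_neg: "0 < r \<Longrightarrow> r < 1 \<Longrightarrow> 2 \<le> d \<Longrightarrow> fundsol d r < 0"
  by (auto simp: fundsol_def intro!: divide_neg_pos mult_pos_pos)

text \<open>A crude bound, but sufficient: it is always multiplied by \<open>rc ^ d\<close>, which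
  leaves one spare power of \<open>rc\<close>.\<close>

lemma fundsol_ge:
  assumes "2 \<le> d" "0 < r" "r < 1"
  shows "- fundsol d r \<le> 1 / r ^ (d - 1)"
proof (cases "d = 2")
  case True
  have "- ln r = ln (1 / r)"
    using assms by (simp add: ln_div)
  also have "\<dots> \<le> 1 / r"
    using assms ln_bound[of "1 / r"] by simp
  finally show ?thesis
    using True by (simp add: fundsol_def)
next
  case False
  then obtain k where k: "d = Suc (Suc (Suc k))"
    using assms(1) by (metis Suc_le_D numeral_2_eq_2 Suc_le_mono not0_implies_Suc)
  have "r * r ^ Suc k \<le> 1 * r ^ Suc k"
    using assms by (intro mult_right_mono) auto
  also have "\<dots> \<le> real (Suc k) * r ^ Suc k"
    using assms by (intro mult_right_mono) auto
  finally have "1 / (real (Suc k) * r ^ Suc k) \<le> 1 / (r * r ^ Suc k)"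
    using assms by (intro divide_left_mono mult_pos_pos) auto
  then show ?thesis
    using k by (simp add: fundsol_def)
qed

lemma fundsol_at_right_0:
  assumes "2 \<le> d"
  shows "filterlim (fundsol d) at_bot (at_right 0)"
proof (cases "d = 2")
  case True
  then have "fundsol d = ln"
    by (auto simp: fundsol_def)
  then show ?thesis
    using ln_at_0 by simp
next
  case False
  have "((\<lambda>r. r ^ (d - 2)) \<longlongrightarrow> 0 ^ (d - 2)) (at_right (0::real))"
    by (intro tendsto_intros)
  then have "filterlim (\<lambda>r. r ^ (d - 2)) (at_right (0::real)) (at_right 0)"
    using assms False
    by (auto simp: filterlim_at power_0_left eventually_at_right_less eventually_at_filter)
  then have "filterlim (\<lambda>r. inverse (r ^ (d - 2))) at_top (at_right (0::real))"
    by (rule filterlim_compose[OF filterlim_inverse_at_top_right])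
  then have "filterlim (\<lambda>r. 1 / real (d - 2) * inverse (r ^ (d - 2))) at_top (at_right (0::real))"
    using assms False by (intro filterlim_tendsto_pos_mult_at_top[OF tendsto_const]) auto
  then show ?thesis
    using False
    by (auto simp: filterlim_uminus_at_top fundsol_def[abs_def] field_simps)
qed

section \<open>Comparison estimates for the solution and its flux\<close>

context radial_solution
begin

text \<open>\<open>K * fundsol d\<close> has constant flux \<open>K\<close>, so its difference with
  \<open>U\<close> is monotone. Differentiability is used only in the open interval, which allows
  \<open>p = e\<close>.\<close>

lemma growth_le:
  assumes "e \<le> p" "p \<le> q" "q \<le> 1" and K: "\<And>r. p < r \<Longrightarrow> r < q \<Longrightarrow> W r \<le> K"
  shows "U q - U p \<le> K * (fundsol d q - fundsol d p)"
proof -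
  have "K * fundsol d p - U p \<le> K * fundsol d q - U q"
  proof (rule DERIV_nonneg_imp_increasing_open[OF assms(2)])
    fix r assume r: "p < r" "r < q"
    then have "((\<lambda>r. K * fundsol d r - U r) has_real_derivative
                  K * (1 / r ^ (d - 1)) - W r / r ^ (d - 1)) (at r)"
      using assms e d by (intro derivative_intros DERIV_cmult fundsol_deriv U_deriv) auto
    moreover have "0 \<le> K * (1 / r ^ (d - 1)) - W r / r ^ (d - 1)"
      using K[OF r] r assms e by (simp add: divide_right_mono)
    ultimately show "\<exists>y. ((\<lambda>r. K * fundsol d r - U r) has_real_derivative y) (at r) \<and> 0 \<le> y"
      by blast
  next
    have "continuous_on {p..q} (fundsol d)"
      using assms e d by (intro fundsol_cont) auto
    moreover have "continuous_on {p..q} U"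
      using U_cont assms by (rule_tac continuous_on_subset) auto
    ultimately show "continuous_on {p..q} (\<lambda>r. K * fundsol d r - U r)"
      by (intro continuous_intros)
  qed
  then show ?thesis
    by (simp add: algebra_simps)
qed

lemma growth_ge:
  assumes "e \<le> p" "p \<le> q" "q \<le> 1" and K: "\<And>r. p < r \<Longrightarrow> r < q \<Longrightarrow> K \<le> W r"
  shows "K * (fundsol d q - fundsol d p) \<le> U q - U p"
proof -
  have "U p - K * fundsol d p \<le> U q - K * fundsol d q"
  proof (rule DERIV_nonneg_imp_increasing_open[OF assms(2)])
    fix r assume r: "p < r" "r < q"
    then have "((\<lambda>r. U r - K * fundsol d r) has_real_derivative
                  W r / r ^ (d - 1) - K * (1 / r ^ (d - 1))) (at r)"
      using assms e d by (intro derivative_intros DERIV_cmult fundsol_deriv U_deriv) auto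
    moreover have "0 \<le> W r / r ^ (d - 1) - K * (1 / r ^ (d - 1))"
      using K[OF r] r assms e by (simp add: divide_right_mono)
    ultimately show "\<exists>y. ((\<lambda>r. U r - K * fundsol d r) has_real_derivative y) (at r) \<and> 0 \<le> y"
      by blast
  next
    have "continuous_on {p..q} (fundsol d)"
      using assms e d by (intro fundsol_cont) auto
    moreover have "continuous_on {p..q} U"
      using U_cont assms by (rule_tac continuous_on_subset) auto
    ultimately show "continuous_on {p..q} (\<lambda>r. U r - K * fundsol d r)"
      by (intro continuous_intros)
  qed
  then show ?thesis
    by (simp add: algebra_simps)
qed

lemma W_cont: "e < p \<Longrightarrow> q < 1 \<Longrightarrow> continuous_on {p..q} W"
  by (rule DERIV_continuous_on, rule has_field_derivative_at_within, rule W_deriv) auto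

text \<open>The derivative of \<open>W r + B * r ^ d / d\<close> is
  \<open>r ^ (d - 1) * (B - f (U r))\<close>, which is nonnegative.\<close>

lemma flux_le:
  assumes "e < p" "p \<le> q" "q < 1" and B: "\<And>r. p < r \<Longrightarrow> r < q \<Longrightarrow> f (U r) \<le> B"
  shows "W p - W q \<le> B * (q ^ d - p ^ d) / d"
proof -
  have "W p + B * p ^ d / d \<le> W q + B * q ^ d / d"
  proof (rule DERIV_nonneg_imp_increasing_open[OF assms(2)])
    fix r assume r: "p < r" "r < q"
    then have "((\<lambda>r. W r + B * r ^ d / d) has_real_derivative
                  - (r ^ (d - 1) * f (U r)) + B * r ^ (d - 1)) (at r)"
      using assms d by (auto intro!: derivative_eq_intros W_deriv)
    moreover have "0 \<le> - (r ^ (d - 1) * f (U r)) + B * r ^ (d - 1)"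
      using mult_right_mono[OF B[OF r], of "r ^ (d - 1)"] r assms e by (simp add: mult.commute)
    ultimately show "\<exists>y. ((\<lambda>r. W r + B * r ^ d / d) has_real_derivative y) (at r) \<and> 0 \<le> y"
      by blast
  qed (use assms d in \<open>auto intro!: continuous_intros W_cont\<close>)
  then show ?thesis
    by (simp add: algebra_simps diff_divide_distrib)
qed

lemma flux_ge:
  assumes "e < p" "p \<le> q" "q < 1" and A: "\<And>r. p < r \<Longrightarrow> r < q \<Longrightarrow> A \<le> f (U r)"
  shows "A * (q ^ d - p ^ d) / d \<le> W p - W q"
proof -
  have "W p + A * p ^ d / d \<ge> W q + A * q ^ d / d"
  proof (rule DERIV_nonpos_imp_decreasing_open[OF assms(2)])
    fix r assume r: "p < r" "r < q"
    then have "((\<lambda>r. W r + A * r ^ d / d) has_real_derivative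
                  - (r ^ (d - 1) * f (U r)) + A * r ^ (d - 1)) (at r)"
      using assms d by (auto intro!: derivative_eq_intros W_deriv)
    moreover have "- (r ^ (d - 1) * f (U r)) + A * r ^ (d - 1) \<le> 0"
      using mult_right_mono[OF A[OF r], of "r ^ (d - 1)"] r assms e by (simp add: mult.commute)
    ultimately show "\<exists>y. ((\<lambda>r. W r + A * r ^ d / d) has_real_derivative y) (at r) \<and> y \<le> 0"
      by blast
  qed (use assms d in \<open>auto intro!: continuous_intros W_cont\<close>)
  then show ?thesis
    by (simp add: algebra_simps diff_divide_distrib)
qed

lemma W_strict_decreasing:
  assumes "e < p" "p < q" "q < 1"
  shows "W q < W p"
proof (rule DERIV_neg_imp_decreasing[OF assms(2)])
  fix r assume "p \<le> r" "r \<le> q"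
  then have "e < r" "r < 1"
    using assms by auto
  moreover from this have "0 < r ^ (d - 1) * f (U r)"
    using e by (intro mult_pos_pos f_pos U_pos) auto
  ultimately show "\<exists>y. (W has_real_derivative y) (at r) \<and> y < 0"
    using W_deriv by fastforce
qed

lemma critical_iff:
  assumes "e < r" "r < 1"
  shows "(U has_real_derivative 0) (at r) \<longleftrightarrow> W r = 0"
proof -
  have "(U has_real_derivative 0) (at r) \<longleftrightarrow> W r / r ^ (d - 1) = 0"
    using U_deriv[OF assms] DERIV_unique by metis
  then show ?thesis
    using assms e by simp
qed

lemma ex_critical: "\<exists>rc. e < rc \<and> rc < 1 \<and> W rc = 0"
proof -
  have "\<exists>z. e < z \<and> z < 1 \<and> (U has_real_derivative 0) (at z)"
    using e U_cont U_bdry U_deriv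
    by (intro Rolle) (auto simp: real_differentiable_def)
  then show ?thesis
    using critical_iff by blast
qed

end

section \<open>Estimates on both sides of the critical point\<close>

text \<open>The bound \<open>M\<close> refers only to \<open>f\<close> and \<open>C\<close>, so that
  one value can serve all inner radii.\<close>

locale radial_critical = radial_solution +
  fixes rc :: real and M :: real
  assumes rc: "e < rc" "rc < 1" "W rc = 0"
    and M: "\<And>s. 0 < s \<Longrightarrow> s \<le> C \<Longrightarrow> f s \<le> M"
begin

lemma critical_set: "{s. e < s \<and> s < 1 \<and> (U has_real_derivative 0) (at s)} = {rc}"
proof -
  have "s = rc" if "e < s" "s < 1" "W s = 0" for s
    using W_strict_decreasing[of s rc] W_strict_decreasing[of rc s] that rc
    by (cases s rc rule: linorder_cases) auto
  then show ?thesis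
    using critical_iff rc by blast
qed

lemma W_nonneg: "e < r \<Longrightarrow> r \<le> rc \<Longrightarrow> 0 \<le> W r"
  using W_strict_decreasing[of r rc] rc by (cases "r = rc") auto

lemma W_nonpos: "rc \<le> r \<Longrightarrow> r < 1 \<Longrightarrow> W r \<le> 0"
  using W_strict_decreasing[of rc r] rc by (cases "r = rc") auto

lemma f_U_le: "e < r \<Longrightarrow> r < 1 \<Longrightarrow> f (U r) \<le> M"
  using M U_pos U_le by blast

lemma M_pos: "0 < M"
  using f_U_le[OF rc(1,2)] f_pos[OF U_pos[OF rc(1,2)]] by linarith

lemma W_le: "e < r \<Longrightarrow> r \<le> rc \<Longrightarrow> W r \<le> M * rc ^ d / d"
proof -
  assume r: "e < r" "r \<le> rc"
  have "W r - W rc \<le> M * (rc ^ d - r ^ d) / d"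
    using r rc f_U_le by (intro flux_le) auto
  also have "\<dots> \<le> M * rc ^ d / d"
    using M_pos r e by (intro divide_right_mono mult_left_mono) auto
  finally show ?thesis using rc by simp
qed

lemma U_mono: "e \<le> p \<Longrightarrow> p \<le> q \<Longrightarrow> q \<le> rc \<Longrightarrow> U p \<le> U q"
  using growth_ge[of p q 0] W_nonneg rc by fastforce

lemma U_antimono: "rc \<le> p \<Longrightarrow> p \<le> q \<Longrightarrow> q < 1 \<Longrightarrow> U q \<le> U p"
  using growth_le[of p q 0] W_nonpos rc by fastforce

text \<open>First estimate with a non-sharp constant: the flux before \<open>rc\<close> is at most
  \<open>M * rc ^ d / d\<close>, and \<open>U\<close> starts from 0 at \<open>e\<close>.\<close>

lemma U_crit_le: "U rc \<le> M * rc ^ d / d * (- fundsol d e)"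
proof -
  have "U rc - U e \<le> M * rc ^ d / d * (fundsol d rc - fundsol d e)"
    using rc W_le by (intro growth_le) auto
  also have "\<dots> \<le> M * rc ^ d / d * (- fundsol d e)"
    using fundsol_neg[of rc d] M_pos rc e d by (intro mult_left_mono) auto
  finally show ?thesis
    by (simp add: U_bdry)
qed

text \<open>A flux of order \<open>rc ^ d\<close> meets a singularity of order
  \<open>rc ^ (1 - d)\<close>, so for fixed \<eta> the solution varies only by \<open>O(rc)\<close>
  between \<open>\<eta> * rc\<close> and \<open>rc\<close>.\<close>

lemma U_drop_left:
  fixes \<eta> :: real
  assumes "0 < \<eta>" "e \<le> \<eta> * rc" "\<eta> * rc \<le> s" "s \<le> rc"
  shows "U rc - U s \<le> M / (d * \<eta> ^ (d - 1)) * rc"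
proof -
  have s: "0 < s" "s < 1" "0 < rc"
    using assms rc e by auto
  have "U rc - U s \<le> M * rc ^ d / d * (fundsol d rc - fundsol d s)"
    using rc W_le assms by (intro growth_le) auto
  also have "\<dots> \<le> M * rc ^ d / d * (1 / s ^ (d - 1))"
    using fundsol_neg[of rc d] fundsol_ge[of d s] M_pos rc e d s by (intro mult_left_mono) auto
  also have "\<dots> \<le> M * rc ^ d / d * (1 / (\<eta> * rc) ^ (d - 1))"
    using M_pos s assms by (intro mult_left_mono divide_left_mono power_mono mult_pos_pos) auto
  also have "\<dots> = M / (d * \<eta> ^ (d - 1)) * rc"
    using s d by (cases d) (auto simp: field_simps)
  finally show ?thesis .
qed

text \<open>The flux lost after \<open>rc\<close> is at most \<open>M * s ^ d / d\<close>, whence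
  \<open>U' \<ge> - M\<close>. This compares the maximum with the value at a fixed radius, where the
  limit of the solutions is known.\<close>

lemma U_drop_right:
  assumes "rc \<le> r" "r < 1"
  shows "U rc - U r \<le> M * r"
proof -
  have "U rc + M * rc \<le> U r + M * r"
  proof (rule DERIV_nonneg_imp_increasing_open[OF assms(1)])
    fix s assume s: "rc < s" "s < r"
    then have s0: "e < s" "0 < s" "s < 1"
      using rc e assms by auto
    have "W rc - W s \<le> M * (s ^ d - rc ^ d) / d"
      using s s0 rc f_U_le by (intro flux_le) auto
    also have "\<dots> \<le> M * s ^ d / 1"
      using M_pos rc e s0 d power_mono[of rc s d] s by (intro frac_le mult_left_mono) auto
    also have "\<dots> \<le> M * s ^ (d - 1) "
      using M_pos s0 by (simp add: power_decreasing)
    finally have "- W s / s ^ (d - 1) \<le> M"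
      using s0 rc by (simp add: field_simps)
    then show "\<exists>y. ((\<lambda>x. U x + M * x) has_real_derivative y) (at s) \<and> 0 \<le> y"
      using s0 by (intro exI[of _ "W s / s ^ (d - 1) + M"])
        (auto intro!: derivative_eq_intros U_deriv)
  next
    show "continuous_on {rc..r} (\<lambda>x. U x + M * x)"
      using U_cont rc assms by (intro continuous_intros continuous_on_subset[OF U_cont]) auto
  qed
  moreover have "0 < M * rc"
    using M_pos rc e by simp
  ultimately show ?thesis by simp
qed

text \<open>The flux is split at \<open>\<eta> * rc\<close>. Beyond that radius
  \<open>f (U r)\<close> is at most \<open>B\<close>; the inner part has only the bound
  \<open>M\<close>, but its contribution to the flux carries the small factor
  \<open>\<eta> ^ d\<close>.\<close>

lemma U_crit_upper:
  assumes "0 < \<eta>" "\<eta> < 1" "e < \<eta> * rc"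
    and B: "\<And>r. \<eta> * rc < r \<Longrightarrow> r < rc \<Longrightarrow> f (U r) \<le> B" and "0 \<le> B"
  shows "U rc \<le> (B + M * \<eta> ^ d) * (rc ^ d / d * (- fundsol d e))"
proof -
  have rc0: "0 < rc" "\<eta> * rc < rc"
    using rc e assms by auto
  have W1: "W r \<le> B * rc ^ d / d" if "\<eta> * rc \<le> r" "r \<le> rc" for r
  proof -
    have "W r - W rc \<le> B * (rc ^ d - r ^ d) / d"
      using that rc assms B by (intro flux_le) auto
    also have "\<dots> \<le> B * rc ^ d / d"
      using that assms e by (intro divide_right_mono mult_left_mono) auto
    finally show ?thesis using rc by simp
  qed
  have "W r \<le> (B + M * \<eta> ^ d) * (rc ^ d / d)" if r: "e < r" "r < rc" for r
  proof (cases "\<eta> * rc \<le> r")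
    case True
    have "0 \<le> M * \<eta> ^ d * (rc ^ d / d)"
      using M_pos assms rc0 by simp
    then show ?thesis
      using W1[OF True] r by (simp add: algebra_simps)
  next
    case False
    have "\<eta> * rc < 1"
      using rc0 rc by linarith
    then have "W r - W (\<eta> * rc) \<le> M * ((\<eta> * rc) ^ d - r ^ d) / d"
      using False r by (intro flux_le f_U_le) auto
    also have "\<dots> \<le> M * (\<eta> * rc) ^ d / d"
      using M_pos r e by (intro divide_right_mono mult_left_mono) auto
    finally show ?thesis
      using W1[of "\<eta> * rc"] rc0 by (simp add: algebra_simps power_mult_distrib)
  qed
  then have "U rc - U e \<le> (B + M * \<eta> ^ d) * (rc ^ d / d) * (fundsol d rc - fundsol d e)"
    using rc by (intro growth_le) auto
  also have "\<dots> \<le> (B + M * \<eta> ^ d) * (rc ^ d / d) * (- fundsol d e)"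
    using fundsol_neg[of rc d] M_pos rc0 rc assms d by (intro mult_left_mono) auto
  finally show ?thesis
    by (simp add: U_bdry mult.assoc)
qed

text \<open>Since \<open>W q\<close> is nonnegative, the flux lost between \<open>p\<close> and
  \<open>q\<close> bounds \<open>W p\<close> from below. The flux is decreasing, so the same bound
  holds on all of \<open>(e, p)\<close> and can be integrated there.\<close>

lemma U_lower:
  assumes "e < p" "p \<le> q" "q \<le> rc" and A: "\<And>r. p < r \<Longrightarrow> r < q \<Longrightarrow> A \<le> f (U r)"
  shows "A * (q ^ d - p ^ d) / d * (fundsol d p - fundsol d e) \<le> U p"
proof -
  have p: "A * (q ^ d - p ^ d) / d \<le> W p"
    using flux_ge[of p q A] A assms rc W_nonneg[of q] by auto
  have "A * (q ^ d - p ^ d) / d \<le> W r" if "e < r" "r < p" for r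
    using W_strict_decreasing[of r p] that p assms rc by auto
  then have "A * (q ^ d - p ^ d) / d * (fundsol d p - fundsol d e) \<le> U p - U e"
    using assms rc by (intro growth_ge) auto
  then show ?thesis
    by (simp add: U_bdry)
qed

end

lemma fundsol_mono:
  assumes "2 \<le> d" "0 < p" "p \<le> q"
  shows "fundsol d p \<le> fundsol d q"
proof (rule DERIV_nonneg_imp_nondecreasing[OF assms(3)])
  fix x assume "p \<le> x" "x \<le> q"
  then show "\<exists>y. (fundsol d has_real_derivative y) (at x) \<and> 0 \<le> y"
    using assms by (intro exI[of _ "1 / x ^ (d - 1)"] conjI fundsol_deriv) auto
qed

section \<open>Limits along the sequence of solutions\<close>

locale radial_sequence =
  fixes d :: nat and f :: "real \<Rightarrow> real" and C M :: real and e rc :: "nat \<Rightarrow> real"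
    and U W :: "nat \<Rightarrow> real \<Rightarrow> real" and U0 :: "real \<Rightarrow> real" and a :: real
  assumes sols: "\<And>n. radial_critical d f C (e n) (U n) (W n) (rc n) M"
    and e_lim: "e \<longlonglongrightarrow> 0"
    and U_lim: "\<And>r. 0 < r \<Longrightarrow> r < 1 \<Longrightarrow> (\<lambda>n. U n r) \<longlonglongrightarrow> U0 r"
    and U0_pos: "\<And>r. 0 < r \<Longrightarrow> r < 1 \<Longrightarrow> 0 < U0 r"
    and U0_lim: "(U0 \<longlongrightarrow> a) (at_right 0)"
    and a: "0 < a"
    and f_cont: "continuous_on UNIV f"
begin

sublocale radial_critical d f C "e n" "U n" "W n" "rc n" M for n
  by (rule sols)

text \<open>A flux of \<open>rc n ^ d / d\<close> carried from \<open>e n\<close> to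
  \<open>rc n\<close> raises the solution by about this amount; the value of \<open>fundsol\<close>
  at \<open>rc n\<close> is dropped as lower order.\<close>

definition Q :: "nat \<Rightarrow> real" where
  "Q n = rc n ^ d / d * (- fundsol d (e n))"

lemma rc_pos: "0 < rc n"
  using rc(1)[of n] e(1)[of n] by linarith

lemma Q_pos: "0 < Q n"
proof -
  have "0 < rc n ^ d / d"
    using rc_pos[of n] d by simp
  then show ?thesis
    using fundsol_neg[OF e d, of n] by (simp add: Q_def mult_pos_neg del: times_divide_eq_left)
qed

lemma fundsol_e_lim: "filterlim (\<lambda>n. fundsol d (e n)) at_bot sequentially"
proof (rule filterlim_compose[OF fundsol_at_right_0[OF d]])
  show "filterlim e (at_right 0) sequentially"
    using e e_lim by (auto simp: filterlim_at less_imp_neq[symmetric])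
qed

text \<open>If \<open>rc n \<ge> \<rho>\<close>, monotonicity keeps \<open>U n\<close> above a fixed
  positive level on \<open>(\<rho> / 2, \<rho>)\<close>. The flux at \<open>\<rho> / 2\<close> is
  then at least a fixed \<open>K > 0\<close>, and integrating from \<open>e n\<close> makes
  \<open>U n (\<rho> / 2)\<close> exceed \<open>C\<close>.\<close>

lemma rc_lim: "rc \<longlonglongrightarrow> 0"
proof -
  have "\<forall>\<^sub>F n in sequentially. rc n < \<rho>" if \<rho>: "0 < \<rho>" "\<rho> < 1" for \<rho>
  proof -
    define c where "c = U0 (\<rho> / 2) / 2"
    have c: "0 < c" "c < U0 (\<rho> / 2)"
      using U0_pos[of "\<rho> / 2"] \<rho> by (auto simp: c_def)
    \<comment> \<open>\<open>m\<close> is the minimum of \<open>f\<close> on \<open>{c..C}\<close>;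
      if that interval is empty, the value 1 is arbitrary.\<close>
    obtain m where m: "0 < m" "\<And>s. c \<le> s \<Longrightarrow> s \<le> C \<Longrightarrow> m \<le> f s"
    proof (cases "{c..C} = {}")
      case True
      then show ?thesis using that[of 1] by auto
    next
      case False
      then obtain s where "s \<in> {c..C}" "\<forall>t\<in>{c..C}. f s \<le> f t"
        using continuous_attains_inf[OF compact_Icc False continuous_on_subset[OF f_cont]] by auto
      then show ?thesis
        using that[of "f s"] f_pos[of s] c by auto
    qed
    define K where "K = m * (\<rho> ^ d - (\<rho> / 2) ^ d) / d"
    have K: "0 < K"
      using \<rho> m d power_strict_mono[of "\<rho> / 2" \<rho> d] by (auto simp: K_def)
    \<comment> \<open>Past this threshold the lower bound
      \<open>K * (fundsol d (\<rho> / 2) - fundsol d (e n))\<close> is larger than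
      \<open>C\<close>.\<close>
    have "\<forall>\<^sub>F n in sequentially. fundsol d (e n) < fundsol d (\<rho> / 2) - C / K"
      using fundsol_e_lim by (simp add: filterlim_at_bot_dense)
    moreover have "\<forall>\<^sub>F n in sequentially. c < U n (\<rho> / 2)"
      using U_lim[of "\<rho> / 2"] \<rho> c by (intro order_tendstoD) auto
    moreover have "\<forall>\<^sub>F n in sequentially. e n < \<rho> / 2"
      using e_lim \<rho> by (intro order_tendstoD) auto
    ultimately show ?thesis
    proof eventually_elim
      case (elim n)
      show ?case
      proof (rule ccontr)
        assume "\<not> rc n < \<rho>"
        then have le: "\<rho> \<le> rc n" by simp
        have "m \<le> f (U n r)" if "\<rho> / 2 < r" "r < \<rho>" for r
        proof (rule m)
          show "c \<le> U n r"
            using U_mono[of n "\<rho> / 2" r] elim that le by auto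
          show "U n r \<le> C"
            using U_le[of n r] elim that \<rho> by auto
        qed
        then have "K * (fundsol d (\<rho> / 2) - fundsol d (e n)) \<le> U n (\<rho> / 2)"
          using U_lower[of n "\<rho> / 2" \<rho> m] elim le \<rho> by (simp add: K_def)
        also have "\<dots> \<le> C"
          using U_le[of n "\<rho> / 2"] elim \<rho> by auto
        finally show False
          using elim K by (simp add: field_simps)
      qed
    qed
  qed
  then have "\<forall>\<^sub>F n in sequentially. rc n < x" if "0 < x" for x
  proof -
    have "\<forall>\<^sub>F n in sequentially. rc n < min x (1 / 2)"
      using \<open>0 < x\<close> by (intro \<open>\<And>\<rho>. 0 < \<rho> \<Longrightarrow> \<rho> < 1 \<Longrightarrow> \<forall>\<^sub>F n in sequentially. rc n < \<rho>\<close>) auto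
    then show ?thesis
      by eventually_elim simp
  qed
  moreover have "x < rc n" if "x < 0" for x n
    using that rc_pos[of n] by linarith
  ultimately show ?thesis
    by (intro order_tendstoI) auto
qed

lemma U_crit_lim: "(\<lambda>n. U n (rc n)) \<longlonglongrightarrow> a"
proof (rule tendstoI)
  fix \<theta> :: real assume \<theta>: "0 < \<theta>"
  \<comment> \<open>The radius \<open>r\<close> is fixed before \<open>n\<close>. One third of the
    error comes from \<open>U0 r\<close> against \<open>a\<close>, one from \<open>M * r\<close>,
    and one from the convergence at this \<open>r\<close>.\<close>
  have "\<forall>\<^sub>F r in at_right 0. dist (U0 r) a < \<theta> / 3"
    using U0_lim \<theta> by (intro tendstoD) auto
  moreover have "\<forall>\<^sub>F r in at_right 0. r < min 1 (\<theta> / (3 * M))"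
    using \<theta> M_pos by (intro eventually_at_rightI[of 0 "min 1 (\<theta> / (3 * M))"]) auto
  moreover have "\<forall>\<^sub>F r in at_right (0::real). 0 < r"
    by (simp add: eventually_at_right_less)
  ultimately have "\<forall>\<^sub>F r in at_right 0. 0 < r \<and> r < 1 \<and> M * r < \<theta> / 3 \<and> dist (U0 r) a < \<theta> / 3"
    by eventually_elim (use M_pos in \<open>auto simp: field_simps\<close>)
  then obtain r where r: "0 < r" "r < 1" "M * r < \<theta> / 3" "dist (U0 r) a < \<theta> / 3"
    using eventually_happens' trivial_limit_at_right_real by blast
  have "\<forall>\<^sub>F n in sequentially. dist (U n r) (U0 r) < \<theta> / 3"
    using U_lim[of r] r \<theta> by (intro tendstoD) auto
  moreover have "\<forall>\<^sub>F n in sequentially. rc n < r"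
    using rc_lim r by (intro order_tendstoD) auto
  ultimately show "\<forall>\<^sub>F n in sequentially. dist (U n (rc n)) a < \<theta>"
  proof eventually_elim
    case (elim n)
    then have "0 \<le> U n (rc n) - U n r" "U n (rc n) - U n r \<le> M * r"
      using U_antimono[of n "rc n" r] U_drop_right[of n r] r by auto
    then show ?case
      using elim r by (simp add: dist_real_def abs_if split: if_splits)
  qed
qed

lemma Q_bounded_below: "\<forall>\<^sub>F n in sequentially. a / (2 * M) \<le> Q n"
proof -
  have "\<forall>\<^sub>F n in sequentially. a / 2 < U n (rc n)"
    using U_crit_lim a by (intro order_tendstoD) auto
  then show ?thesis
  proof eventually_elim
    case (elim n)
    moreover have "M * rc n ^ d / d * (- fundsol d (e n)) = M * Q n"
      by (simp add: Q_def)
    ultimately have "a / 2 \<le> M * Q n"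
      using U_crit_le[of n] by linarith
    then show ?case
      using M_pos by (simp add: field_simps)
  qed
qed

text \<open>Boundedness of \<open>Q\<close> from below turns \<open>1 / fundsol d (e n)\<close> into a multiple of
  \<open>rc n ^ d\<close>, which beats the singularity \<open>1 / rc n ^ (d - 1)\<close>.\<close>
lemma fundsol_ratio_lim:
  assumes \<eta>: "0 < \<eta>" "\<eta> < 1"
  shows "(\<lambda>n. fundsol d (\<eta> * rc n) / fundsol d (e n)) \<longlonglongrightarrow> 0"
proof (rule tendsto_sandwich[OF _ _ tendsto_const])
  let ?c = "a / (2 * M)"
  let ?h = "\<lambda>n. rc n / (d * ?c * \<eta> ^ (d - 1))"
  have x: "0 < \<eta> * rc n" "\<eta> * rc n < 1" for n
    using \<eta> rc_pos[of n] rc(2)[of n] mult_strict_mono[of \<eta> 1 "rc n" 1] by auto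
  show "\<forall>\<^sub>F n in sequentially. 0 \<le> fundsol d (\<eta> * rc n) / fundsol d (e n)"
    using fundsol_neg[OF x d] fundsol_neg[OF e d]
    by (intro always_eventually allI divide_nonpos_nonpos) (auto intro: less_imp_le)
  show "\<forall>\<^sub>F n in sequentially. fundsol d (\<eta> * rc n) / fundsol d (e n) \<le> ?h n"
    using Q_bounded_below
  proof eventually_elim
    case (elim n)
    have c: "0 < ?c" "0 < real d"
      using a M_pos d by auto
    have E: "0 < - fundsol d (e n)"
      using fundsol_neg[OF e d] by simp
    have "fundsol d (\<eta> * rc n) / fundsol d (e n) = - fundsol d (\<eta> * rc n) / - fundsol d (e n)"
      by simp
    also have "\<dots> \<le> (1 / (\<eta> * rc n) ^ (d - 1)) / - fundsol d (e n)"
      using E fundsol_ge[OF d x] by (intro divide_right_mono) auto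
    also have "\<dots> = 1 / (\<eta> * rc n) ^ (d - 1) * (1 / - fundsol d (e n))"
      by simp
    also have "\<dots> \<le> 1 / (\<eta> * rc n) ^ (d - 1) * (rc n ^ d / (d * ?c))"
    proof (rule mult_left_mono)
      have "d * ?c \<le> rc n ^ d * - fundsol d (e n)"
        using elim c unfolding Q_def by (simp add: field_simps)
      moreover have "1 / x \<le> y / z" if "0 < x" "0 < z" "z \<le> y * x" for x y z :: real
        using that by (simp add: field_simps)
      ultimately show "1 / - fundsol d (e n) \<le> rc n ^ d / (d * ?c)"
        using E mult_pos_pos[of "real d" ?c] c by blast
    qed (use x[of n] in auto)
    also have "\<dots> = ?h n"
      using rc_pos[of n] d by (cases d) (auto simp: field_simps)
    finally show ?case .
  qed
  have "(\<lambda>n. rc n / (d * ?c * \<eta> ^ (d - 1))) \<longlonglongrightarrow> 0 / (d * ?c * \<eta> ^ (d - 1))"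
    using rc_lim a M_pos d \<eta> by (intro tendsto_intros) auto
  then show "?h \<longlonglongrightarrow> 0" by simp
qed

text \<open>If \<open>\<eta> * rc n \<le> e n\<close>, monotonicity and negativity of
  \<open>fundsol\<close> would make the ratio at least 1, while it tends to 0.\<close>

lemma e_less_rc:
  assumes \<eta>: "0 < \<eta>" "\<eta> < 1"
  shows "\<forall>\<^sub>F n in sequentially. e n < \<eta> * rc n"
proof -
  have "\<forall>\<^sub>F n in sequentially. fundsol d (\<eta> * rc n) / fundsol d (e n) < 1"
    using fundsol_ratio_lim[OF \<eta>] by (intro order_tendstoD) auto
  then show ?thesis
  proof eventually_elim
    case (elim n)
    then have "fundsol d (e n) < fundsol d (\<eta> * rc n)"
      using fundsol_neg[OF e d, of n] by (simp add: field_simps)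
    then show ?case
      using fundsol_mono[OF d, of "\<eta> * rc n" "e n"] \<eta> rc_pos[of n] by force
  qed
qed

text \<open>\<open>U_drop_left\<close> puts \<open>U n r\<close> within \<open>O(rc n)\<close> of
  the maximum, uniformly in \<open>r\<close>, and the maximum tends to \<open>a\<close>; continuity
  of \<open>f\<close> at \<open>a\<close> does the rest.\<close>

lemma f_U_near:
  assumes \<eta>: "0 < \<eta>" "\<eta> < 1" and \<theta>: "0 < \<theta>"
  shows "\<forall>\<^sub>F n in sequentially. \<forall>r. \<eta> * rc n < r \<and> r < rc n \<longrightarrow> \<bar>f (U n r) - f a\<bar> < \<theta>"
proof -
  have "isCont f a"
    using f_cont by (simp add: continuous_on_eq_continuous_at)
  then obtain \<delta> where \<delta>: "0 < \<delta>" "\<And>x. \<bar>x - a\<bar> < \<delta> \<Longrightarrow> \<bar>f x - f a\<bar> < \<theta>"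
    using \<theta> unfolding continuous_at_eps_delta dist_real_def by blast
  define k where "k = M / (d * \<eta> ^ (d - 1))"
  have "(\<lambda>n. \<bar>U n (rc n) - a\<bar> + k * rc n) \<longlonglongrightarrow> \<bar>a - a\<bar> + k * 0"
    by (intro tendsto_intros U_crit_lim rc_lim)
  then have "\<forall>\<^sub>F n in sequentially. \<bar>U n (rc n) - a\<bar> + k * rc n < \<delta>"
    using \<delta> by (intro order_tendstoD) auto
  then show ?thesis
    using e_less_rc[OF \<eta>]
  proof eventually_elim
    case (elim n)
    show ?case
    proof (intro allI impI \<delta>)
      fix r assume r: "\<eta> * rc n < r \<and> r < rc n"
      have "U n r \<le> U n (rc n)"
        using U_mono[of n r "rc n"] elim r by auto
      moreover have "U n (rc n) - U n r \<le> k * rc n"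
        using U_drop_left[of \<eta> n r] elim r \<eta> by (auto simp: k_def)
      ultimately show "\<bar>U n r - a\<bar> < \<delta>"
        using elim by linarith
    qed
  qed
qed

text \<open>For fixed \<eta> the sharp upper and lower estimates enclose the quotient up to errors
  that vanish with \<eta>; so \<eta> is chosen first, according to the margin, and then
  \<open>n\<close> is taken large.\<close>

lemma U_crit_div_Q_lim: "(\<lambda>n. U n (rc n) / Q n) \<longlonglongrightarrow> f a"
proof (rule order_tendstoI)
  have fa: "0 < f a"
    using f_pos a by blast
  fix B assume B: "f a < B"
  \<comment> \<open>One parameter has two roles: the fraction of \<open>rc n\<close> at which the
    flux is split, and the tolerance for \<open>f (U n r)\<close> around \<open>f a\<close>.\<close>
  have "((\<lambda>\<eta>. f a + \<eta> + M * \<eta> ^ d) \<longlongrightarrow> f a + 0 + M * 0 ^ d) (at_right 0)"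
    by (intro tendsto_intros)
  then have "\<forall>\<^sub>F \<eta> in at_right 0. f a + \<eta> + M * \<eta> ^ d < B"
    using B d by (intro order_tendstoD) (auto simp: power_0_left)
  moreover have "\<forall>\<^sub>F \<eta> in at_right 0. \<eta> \<in> {0<..<1::real}"
    by (intro eventually_at_right_real) auto
  ultimately have ev: "\<forall>\<^sub>F \<eta> in at_right 0. f a + \<eta> + M * \<eta> ^ d < B \<and> \<eta> \<in> {0<..<1}"
    by eventually_elim auto
  obtain \<eta> where \<eta>: "0 < \<eta>" "\<eta> < 1" "f a + \<eta> + M * \<eta> ^ d < B"
    using eventually_happens'[OF trivial_limit_at_right_real ev] by auto
  show "\<forall>\<^sub>F n in sequentially. U n (rc n) / Q n < B"
    using e_less_rc[OF \<eta>(1,2)] f_U_near[OF \<eta>(1,2,1)]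
  proof eventually_elim
    case (elim n)
    have "U n (rc n) \<le> (f a + \<eta> + M * \<eta> ^ d) * Q n"
      unfolding Q_def
    proof (rule U_crit_upper)
      show "f (U n r) \<le> f a + \<eta>" if "\<eta> * rc n < r" "r < rc n" for r
        using elim that by (auto simp: abs_less_iff dest!: spec[of _ r])
    qed (use elim \<eta> fa in auto)
    also have "\<dots> < B * Q n"
      using \<eta> Q_pos by (intro mult_strict_right_mono)
    finally show ?case
      using Q_pos[of n] by (simp add: field_simps)
  qed
next
  have fa: "0 < f a"
    using f_pos a by blast
  fix A assume A: "A < f a"
  \<comment> \<open>The factor \<open>1 - \<eta> ^ d\<close> is the share of the flux produced
    between \<open>\<eta> * rc n\<close> and \<open>rc n\<close>. Stopping the integration at
    \<open>\<eta> * rc n\<close> costs the further factor \<open>1 - ?\<kappa> n\<close>, which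
    tends to 1.\<close>
  have "((\<lambda>\<eta>. (f a - \<eta>) * (1 - \<eta> ^ d)) \<longlongrightarrow> (f a - 0) * (1 - 0 ^ d)) (at_right 0)"
    by (intro tendsto_intros)
  then have "\<forall>\<^sub>F \<eta> in at_right 0. A < (f a - \<eta>) * (1 - \<eta> ^ d)"
    using A d by (intro order_tendstoD) (auto simp: power_0_left)
  moreover have "\<forall>\<^sub>F \<eta> in at_right 0. \<eta> \<in> {0<..<1::real}"
    by (intro eventually_at_right_real) auto
  ultimately have ev: "\<forall>\<^sub>F \<eta> in at_right 0. A < (f a - \<eta>) * (1 - \<eta> ^ d) \<and> \<eta> \<in> {0<..<1}"
    by eventually_elim auto
  obtain \<eta> where \<eta>: "0 < \<eta>" "\<eta> < 1" "A < (f a - \<eta>) * (1 - \<eta> ^ d)"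
    using eventually_happens'[OF trivial_limit_at_right_real ev] by auto
  let ?\<kappa> = "\<lambda>n. fundsol d (\<eta> * rc n) / fundsol d (e n)"
  have "(\<lambda>n. (f a - \<eta>) * (1 - \<eta> ^ d) * (1 - ?\<kappa> n)) \<longlonglongrightarrow> (f a - \<eta>) * (1 - \<eta> ^ d) * (1 - 0)"
    by (intro tendsto_intros fundsol_ratio_lim \<eta>)
  then have "\<forall>\<^sub>F n in sequentially. A < (f a - \<eta>) * (1 - \<eta> ^ d) * (1 - ?\<kappa> n)"
    using \<eta> by (intro order_tendstoD) auto
  then show "\<forall>\<^sub>F n in sequentially. A < U n (rc n) / Q n"
    using e_less_rc[OF \<eta>(1,2)] f_U_near[OF \<eta>(1,2,1)]
  proof eventually_elim
    case (elim n)
    have E: "fundsol d (e n) \<noteq> 0"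
      using fundsol_neg[OF e d, of n] by simp
    have lt: "\<eta> * rc n < rc n"
      using \<eta> rc_pos[of n] by simp
    have "A * Q n < (f a - \<eta>) * (1 - \<eta> ^ d) * (1 - ?\<kappa> n) * Q n"
      using elim Q_pos by (intro mult_strict_right_mono)
    also have "\<dots> = (f a - \<eta>) * (rc n ^ d - (\<eta> * rc n) ^ d) / d
                    * (fundsol d (\<eta> * rc n) - fundsol d (e n))"
      using E d by (simp add: Q_def field_simps power_mult_distrib)
    also have "\<dots> \<le> U n (\<eta> * rc n)"
    proof (rule U_lower)
      show "f a - \<eta> \<le> f (U n r)" if "\<eta> * rc n < r" "r < rc n" for r
        using elim that by (auto simp: abs_less_iff dest!: spec[of _ r])
    qed (use elim lt in auto)
    also have "\<dots> \<le> U n (rc n)"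
      using elim lt by (intro U_mono) auto
    finally show ?case
      using Q_pos[of n] by (simp add: field_simps)
  qed
qed

text \<open>The left side is \<open>d * Q n\<close>, and \<open>Q n\<close> is the quotient of
  \<open>U n (rc n)\<close> by \<open>U n (rc n) / Q n\<close>, both of which have known
  limits.\<close>

lemma rc_asymptotics: "(\<lambda>n. rc n ^ d * (- fundsol d (e n))) \<longlonglongrightarrow> d * a / f a"
proof -
  have fa: "f a \<noteq> 0"
    using f_pos[OF a] by simp
  have "(\<lambda>n. d * (U n (rc n) / (U n (rc n) / Q n))) \<longlonglongrightarrow> d * (a / f a)"
    by (intro tendsto_intros U_crit_lim U_crit_div_Q_lim fa)
  moreover have "d * (U n (rc n) / (U n (rc n) / Q n)) = rc n ^ d * (- fundsol d (e n))" for n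
    using Q_pos[of n] U_pos[OF rc(1,2), of n] d by (simp add: Q_def)
  ultimately show ?thesis by simp
qed

end

section \<open>Transfer to the boundary value problem and extraction of the rates\<close>

theorem corollary1p11:
  fixes f :: "real \<Rightarrow> real"
    and N :: nat
    and \<epsilon> :: "nat \<Rightarrow> real"
    and u :: "nat \<Rightarrow> real \<Rightarrow> real"
    and u\<^sub>0 :: "real ^ 'n \<Rightarrow> real"
    and C :: real
  assumes N: "N = CARD('n)" "N \<ge> 2"
    and f_smooth: "smooth f"
    and f_pos: "\<And>s. s > 0 \<Longrightarrow> f s > 0"
    and eps: "\<And>n. 0 < \<epsilon> n \<and> \<epsilon> n < 1" "\<epsilon> \<longlonglongrightarrow> 0"
    and sol: "\<And>n. positive_solution f (annulus (\<epsilon> n)) (\<lambda>x :: real ^ 'n. u n (norm x))"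
    and bound: "\<And>n. \<forall>x :: real ^ 'n \<in> annulus (\<epsilon> n). \<bar>u n (norm x)\<bar> \<le> C"
    and weak_lim: "weakly_converges_H10 (ball 0 1)
                     (\<lambda>n. zero_ext (\<epsilon> n) (\<lambda>x. u n (norm x))) u\<^sub>0"
    and C2_lim: "\<And>K. compact K \<Longrightarrow> K \<subseteq> ball 0 1 - {0} \<Longrightarrow>
                   C2_converges_on K (\<lambda>n. zero_ext (\<epsilon> n) (\<lambda>x. u n (norm x))) u\<^sub>0"
    and u0_sol: "positive_solution f (ball 0 1) u\<^sub>0"
  shows "\<exists>r \<delta> :: nat \<Rightarrow> real.
           (\<forall>\<^sub>F n in sequentially.
              {s. \<epsilon> n < s \<and> s < 1 \<and> (u n has_real_derivative 0) (at s)} = {r n}) \<and>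
           \<delta> \<longlonglongrightarrow> 0 \<and>
           (\<forall>\<^sub>F n in sequentially.
              r n = (if N \<ge> 3
                     then ((real N * (real N - 2) * u\<^sub>0 0 / f (u\<^sub>0 0)) powr (1 / real N) + \<delta> n)
                            * \<epsilon> n powr ((real N - 2) / real N)
                     else (sqrt (2 * u\<^sub>0 0 / f (u\<^sub>0 0)) + \<delta> n) * (1 / sqrt \<bar>ln (\<epsilon> n)\<bar>)))"
proof -
  obtain b :: "real ^ 'n" where b: "b \<in> Basis"
    using nonempty_Basis by blast
  have d: "2 \<le> DIM(real ^ 'n)" and dN: "DIM(real ^ 'n) = N"
    using N by auto
  have f_cont: "continuous_on UNIV f"
    using f_smooth Ck_on.simps(1) unfolding smooth_def by blast
  obtain M where M: "\<And>s. 0 < s \<Longrightarrow> s \<le> C \<Longrightarrow> f s \<le> M"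
  proof -
    have "bounded (f ` {0..C})"
      by (intro compact_imp_bounded compact_continuous_image continuous_on_subset[OF f_cont]) auto
    then obtain M where "\<forall>x\<in>f ` {0..C}. norm x \<le> M"
      by (auto simp: bounded_iff)
    then have "f s \<le> M" if "0 < s" "s \<le> C" for s
      using that by (fastforce simp: abs_le_iff)
    then show thesis
      using that by blast
  qed
  have "\<exists>W. radial_solution N f C (\<epsilon> n) (u n) W" for n
    using positive_solution_radial[OF sol d f_pos _ _ bound] eps(1) dN by auto
  then obtain W where W: "\<And>n. radial_solution N f C (\<epsilon> n) (u n) (W n)"
    by metis
  have "\<exists>rc. \<epsilon> n < rc \<and> rc < 1 \<and> W n rc = 0" for n
    by (rule radial_solution.ex_critical[OF W])
  then obtain r where r: "\<And>n. \<epsilon> n < r n" "\<And>n. r n < 1" "\<And>n. W n (r n) = 0"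
    by metis
  have crit: "radial_critical N f C (\<epsilon> n) (u n) (W n) (r n) M" for n
    using W r M by (simp add: radial_critical_def radial_critical_axioms_def)
  define U0 where "U0 s = u\<^sub>0 (s *\<^sub>R b)" for s
  have seq: "radial_sequence N f C M \<epsilon> r u W U0 (u\<^sub>0 0)"
  proof (rule radial_sequence.intro)
    show "radial_critical N f C (\<epsilon> n) (u n) (W n) (r n) M" for n
      by (rule crit)
    show "\<epsilon> \<longlonglongrightarrow> 0" "continuous_on UNIV f"
      by (fact eps f_cont)+
    show "(\<lambda>n. u n s) \<longlonglongrightarrow> U0 s" if s: "0 < s" "s < 1" for s
    proof -
      \<comment> \<open>A single point is a compact set, so convergence at each radius follows; the
        extension by 0 is invisible once \<open>\<epsilon> n < s\<close>.\<close>
      have "C2_converges_on {s *\<^sub>R b} (\<lambda>n. zero_ext (\<epsilon> n) (\<lambda>x. u n (norm x))) u\<^sub>0"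
        using s b by (intro C2_lim) auto
      then have "(\<lambda>n. zero_ext (\<epsilon> n) (\<lambda>x. u n (norm x)) (s *\<^sub>R b)) \<longlonglongrightarrow> U0 s"
        unfolding C2_converges_on_def U0_def by (auto intro: tendsto_uniform_limitI)
      moreover have "\<forall>\<^sub>F n in sequentially. \<epsilon> n < s"
        using eps(2) s by (intro order_tendstoD) auto
      then have "\<forall>\<^sub>F n in sequentially. zero_ext (\<epsilon> n) (\<lambda>x. u n (norm x)) (s *\<^sub>R b) = u n s"
        by eventually_elim (use s b in \<open>auto simp: zero_ext_def\<close>)
      ultimately show ?thesis
        by (rule Lim_transform_eventually)
    qed
    show "0 < U0 s" if "0 < s" "s < 1" for s
      using u0_sol b that by (auto simp: positive_solution_def U0_def)
    show "0 < u\<^sub>0 0"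
      using u0_sol by (auto simp: positive_solution_def)
    have "continuous_on (ball 0 1) u\<^sub>0"
      using u0_sol closure_subset by (auto simp: positive_solution_def intro: continuous_on_subset)
    then have "isCont u\<^sub>0 (0 *\<^sub>R b)"
      by (simp add: continuous_on_eq_continuous_at)
    moreover have "isCont (\<lambda>s. s *\<^sub>R b) 0"
      by (intro continuous_intros)
    ultimately have "isCont U0 0"
      unfolding U0_def[abs_def] by (rule isCont_o2[rotated])
    then show "(U0 \<longlongrightarrow> u\<^sub>0 0) (at_right 0)"
      by (auto simp: isCont_def U0_def intro: tendsto_within_subset)
  qed
  let ?a = "u\<^sub>0 0"
  have asymp: "(\<lambda>n. r n ^ N * (- fundsol N (\<epsilon> n))) \<longlonglongrightarrow> N * ?a / f ?a"
    by (rule radial_sequence.rc_asymptotics[OF seq])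
  have a: "0 < ?a" "0 < f ?a"
    using u0_sol f_pos by (auto simp: positive_solution_def)
  have rpos: "0 < r n" for n
    using r(1)[of n] eps(1)[of n] by linarith
  \<comment> \<open>With \<open>L\<close> the limiting coefficient and \<open>g\<close> the rate, it
    remains to show that \<open>r n / g n\<close> tends to \<open>L\<close>; the error sequence is
    then \<open>r n / g n - L\<close>.\<close>
  define L where "L = (if N \<ge> 3 then (real N * (real N - 2) * ?a / f ?a) powr (1 / real N)
                        else sqrt (2 * ?a / f ?a))"
  define g where "g n = (if N \<ge> 3 then \<epsilon> n powr ((real N - 2) / real N)
                          else 1 / sqrt \<bar>ln (\<epsilon> n)\<bar>)" for n
  have g: "g n \<noteq> 0" for n
    using eps(1)[of n] by (auto simp: g_def)
  have lim: "(\<lambda>n. r n / g n) \<longlonglongrightarrow> L"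
  proof (cases "N \<ge> 3")
    case True
    have "(\<lambda>n. ((real N - 2) * (r n ^ N * (- fundsol N (\<epsilon> n)))) powr (1 / real N))
            \<longlonglongrightarrow> ((real N - 2) * (N * ?a / f ?a)) powr (1 / real N)"
      using True a by (intro tendsto_intros asymp) auto
    moreover have "((real N - 2) * (r n ^ N * (- fundsol N (\<epsilon> n)))) powr (1 / real N) = r n / g n" for n
    proof -
      \<comment> \<open>The factor \<open>real N - 2\<close> clears the denominator of
        \<open>fundsol\<close> and is also the one that appears in the coefficient.\<close>
      have "(real N - 2) * (r n ^ N * (- fundsol N (\<epsilon> n))) = r n ^ N / \<epsilon> n ^ (N - 2)"
        using True eps(1)[of n] by (simp add: fundsol_def of_nat_diff)
      also have "\<dots> = r n powr N / \<epsilon> n powr (real N - 2)"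
        using True eps(1)[of n] rpos[of n] by (simp add: powr_realpow[symmetric] of_nat_diff)
      also have "\<dots> powr (1 / real N) = r n / g n"
        using True eps(1)[of n] rpos[of n] by (simp add: powr_divide powr_powr g_def)
      finally show ?thesis .
    qed
    ultimately show ?thesis
      using True by (simp add: L_def mult_ac)
  next
    case False
    then have N2: "N = 2"
      using N by simp
    have "(\<lambda>n. sqrt (r n ^ N * (- fundsol N (\<epsilon> n)))) \<longlonglongrightarrow> sqrt (N * ?a / f ?a)"
      by (intro tendsto_intros asymp)
    moreover have "sqrt (r n ^ N * (- fundsol N (\<epsilon> n))) = r n / g n" for n
      using N2 rpos[of n] eps(1)[of n]
        real_sqrt_mult[of "(r n)\<^sup>2" "- ln (\<epsilon> n)"]
      by (simp add: fundsol_def g_def)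
    ultimately show ?thesis
      using N2 by (simp add: L_def)
  qed
  show ?thesis
  proof (intro exI conjI)
    show "\<forall>\<^sub>F n in sequentially.
        {s. \<epsilon> n < s \<and> s < 1 \<and> (u n has_real_derivative 0) (at s)} = {r n}"
      using radial_critical.critical_set[OF crit] by simp
    show "(\<lambda>n. r n / g n - L) \<longlonglongrightarrow> 0"
      using tendsto_diff[OF lim tendsto_const[of L]] by simp
    have r_eq: "r n = (L + (r n / g n - L)) * g n" for n
      using g[of n] by simp
    have split: "(L + x) * g n = (if N \<ge> 3
                     then ((real N * (real N - 2) * u\<^sub>0 0 / f (u\<^sub>0 0)) powr (1 / real N) + x)
                            * \<epsilon> n powr ((real N - 2) / real N)
                     else (sqrt (2 * u\<^sub>0 0 / f (u\<^sub>0 0)) + x) * (1 / sqrt \<bar>ln (\<epsilon> n)\<bar>))" for n x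
      by (simp add: L_def g_def)
    show "\<forall>\<^sub>F n in sequentially.
              r n = (if N \<ge> 3
                     then ((real N * (real N - 2) * u\<^sub>0 0 / f (u\<^sub>0 0)) powr (1 / real N) + (r n / g n - L))
                            * \<epsilon> n powr ((real N - 2) / real N)
                     else (sqrt (2 * u\<^sub>0 0 / f (u\<^sub>0 0)) + (r n / g n - L)) * (1 / sqrt \<bar>ln (\<epsilon> n)\<bar>))"
      by (intro always_eventually allI trans[OF r_eq split])
  qed
qed

end
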